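(* Let $E_0:y^2=x^3+8x$ over $\mathbb{Q}$ and for each prime $p\neq2$ let $a_p=p+1-\#E_0(\mathbb{F}_p)$. Let $L_S=\operatorname{diag}(1,-1)$, $V=\begin{pmatrix}1&1\\-1&1\end{pmatrix}$, and for $(u,\lambda)\in\mathbb{C}^2$, $u\neq0$, let $A(u;\lambda)=u^2I_2-L_S-\lambda u^{-1}V$, $R(u;\lambda)=A(u;\lambda)^{-1}$ when invertible, and $P(u;\lambda)=u^2\det A(u;\lambda)=u^6-u^2-2\lambda u^3+2\lambda^2$. For every prime $p\neq2$ set \[\Delta_p=4p(p+1)-a_p^2,\qquad w_p^{\pm}=\frac{a_p\pm\sqrt{\Delta_p}}{2p},\] and $\lambda_p^{\pm}=(w_p^{\pm})^{3/2}-\frac{a_p}{2p}(w_p^{\pm})^{1/2}$ (principal branch). Then: (a) $\Delta_p>0$; (b) $w_p^{+}>0$, and the two choices $u=\pm\sqrt{w_p^+}$ give two real basepoints $(\sqrt{w_p^+},\lambda_p^+)$ and $(-\sqrt{w_p^+},-\lambda_p^+)$; $w_p^-<0$ and yields complex basepoints; every real basepoint lies off the curve $P=0$, with $P(\sqrt{w_p^+};\lambda_p^+)=P(-\sqrt{w_p^+};-\lambda_p^+)=w_p^+/p$; (c) with $u_p=\sqrt{w_p^+}$, \[\det\bigl(I_2-p^{-s}R(u_p;\lambda_p^+)\bigr)=1-a_pp^{-s}+p^{1-2s}\] as polynomials in $p^{-s}$; the identity also holds algebraically when $w_p^-$ (with a square root $u$ of $w_p^-$ and the corresponding $\lambda_p^-$)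 is substituted, though the resulting basepoint is not real.
   Context: The right-hand side of (c) is the inverse local Euler factor $L_p(E_0,s)^{-1}$ of the Hasse–Weil $L$-function of $E_0$ at the good prime $p$. Here $R$ is the resolvent of the operator pencil $z I-L_S-\lambda z^{-1/2}V$ written in the variable $u=z^{1/2}$. *)

theory Defs
  imports
    "HOL-Analysis.Analysis"
    "HOL-Computational_Algebra.Polynomial"
    "HOL-Number_Theory.Cong"
begin

text \<open>
  The field with \<open>p\<close> elements is represented by the residues \<open>0, \<dots>, p - 1\<close>;
  \<^term>\<open>None\<close> is the point at infinity.
\<close>

definition weierstrass_points :: "int \<Rightarrow> int \<Rightarrow> nat \<Rightarrow> (int \<times> int) option set" where
  "weierstrass_points A B p =
     insert None (Some ` {(x, y). x \<in> {0..<int p} \<and> y \<in> {0..<int p} \<and>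
                                  [y\<^sup>2 = x ^ 3 + A * x + B] (mod int p)})"

definition E0_points :: "nat \<Rightarrow> (int \<times> int) option set" where
  "E0_points = weierstrass_points 8 0"

definition a_p :: "nat \<Rightarrow> int" where
  "a_p p = int p + 1 - int (card (E0_points p))"

definition L_S :: "complex ^ 2 ^ 2" where
  "L_S = vector [vector [1, 0], vector [0, -1]]"

definition V :: "complex ^ 2 ^ 2" where
  "V = vector [vector [1, 1], vector [-1, 1]]"

definition pencil :: "complex \<Rightarrow> complex \<Rightarrow> complex ^ 2 ^ 2" where
  "pencil u l = mat (u\<^sup>2) - L_S - map_matrix ((*) (l * inverse u)) V"

text \<open>
  \<^term>\<open>matrix_inv\<close> is unspecified on singular matrices, so statements about the
  resolvent have to assert invertibility of the pencil separately.
\<close>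

definition resolvent :: "complex \<Rightarrow> complex \<Rightarrow> complex ^ 2 ^ 2" where
  "resolvent u l = matrix_inv (pencil u l)"

definition P :: "complex \<Rightarrow> complex \<Rightarrow> complex" where
  "P u l = u\<^sup>2 * det (pencil u l)"

definition Delta :: "nat \<Rightarrow> int" where
  "Delta p = 4 * int p * (int p + 1) - (a_p p)\<^sup>2"

definition w_plus :: "nat \<Rightarrow> real" where
  "w_plus p = (of_int (a_p p) + sqrt (of_int (Delta p))) / (2 * of_nat p)"

definition w_minus :: "nat \<Rightarrow> real" where
  "w_minus p = (of_int (a_p p) - sqrt (of_int (Delta p))) / (2 * of_nat p)"

text \<open>Complex \<^term>\<open>(powr)\<close> is the principal branch, also on the negative real axis.\<close>

definition lambda_of :: "nat \<Rightarrow> real \<Rightarrow> complex" where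
  "lambda_of p w = complex_of_real w powr (3/2)
     - of_int (a_p p) / (2 * of_nat p) * complex_of_real w powr (1/2)"

definition lambda_plus :: "nat \<Rightarrow> complex" where
  "lambda_plus p = lambda_of p (w_plus p)"

definition lambda_minus :: "nat \<Rightarrow> complex" where
  "lambda_minus p = lambda_of p (w_minus p)"

text \<open>
  The points \<open>(u, \<lambda>)\<close> obtained from \<open>w\<close> by a choice of square root \<open>u\<close>: the principal
  root goes with the principal value of \<open>\<lambda>\<close>, and since \<open>\<lambda>\<close> is odd in \<open>w\<^sup>1\<^sup>/\<^sup>2\<close>, the
  other root goes with its negative.
\<close>

definition basepoints_of :: "nat \<Rightarrow> real \<Rightarrow> (complex \<times> complex) set" where
  "basepoints_of p w =
     {(u, l). u\<^sup>2 = complex_of_real w \<and>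
              l = (if u = csqrt (complex_of_real w) then lambda_of p w else - lambda_of p w)}"

definition basepoints :: "nat \<Rightarrow> (complex \<times> complex) set" where
  "basepoints p = basepoints_of p (w_plus p) \<union> basepoints_of p (w_minus p)"

definition real_point :: "complex \<times> complex \<Rightarrow> bool" where
  "real_point b \<longleftrightarrow> fst b \<in> \<real> \<and> snd b \<in> \<real>"

end

theory Submission
  imports Defs
begin

text \<open>
  Put \<open>b = a\<^sub>p / (2 p)\<close>. At a basepoint \<open>u\<^sup>2 = w\<close> and \<open>\<lambda> = u (w - b)\<close>, so the pencil has trace
  \<open>2 w - 2 (w - b) = 2 b = a\<^sub>p / p\<close> and determinant \<open>(w - b)\<^sup>2 + b\<^sup>2 - 1\<close>. The numbers \<open>w\<^sub>p\<^sup>\<plusminus>\<close> are the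
  two solutions of \<open>(w - b)\<^sup>2 + b\<^sup>2 = 1 + 1 / p\<close>, so the determinant is \<open>1 / p\<close> and the resolvent has
  trace \<open>a\<^sub>p\<close> and determinant \<open>p\<close>. For the signs of \<open>\<Delta>\<^sub>p\<close> and \<open>w\<^sub>p\<^sup>\<plusminus>\<close> Hasse's theorem is not needed:
  each \<open>x\<close> carries at most two points of the curve, and the resulting bound \<open>\<bar>a\<^sub>p\<bar> \<le> p\<close> suffices.
\<close>

section \<open>Counting points modulo a prime\<close>

lemma card_sqrt_mod_prime_le_2:
  fixes c :: int
  assumes "prime p"
  shows "card {y \<in> {0..<int p}. [y\<^sup>2 = c] (mod int p)} \<le> 2"
proof (cases "{y \<in> {0..<int p}. [y\<^sup>2 = c] (mod int p)} = {}")
  case False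
  then obtain z where z: "[z\<^sup>2 = c] (mod int p)" by blast
  have "{y \<in> {0..<int p}. [y\<^sup>2 = c] (mod int p)} \<subseteq> {z mod int p, (- z) mod int p}"
  proof
    fix y assume "y \<in> {y \<in> {0..<int p}. [y\<^sup>2 = c] (mod int p)}"
    then have y: "0 \<le> y" "y < int p" "[y\<^sup>2 = c] (mod int p)"
      by auto
    have "[y\<^sup>2 = z\<^sup>2] (mod int p)"
      using y z by (meson cong_sym cong_trans)
    \<comment> \<open>With one root \<open>z\<close> fixed, the difference of squares factors, and
      primality of \<open>p\<close> forces any other root to be congruent to \<open>z\<close> or
      \<open>-z\<close>.\<close>
    then have "int p dvd (y - z) * (y - (- z))"
      by (simp add: cong_iff_dvd_diff algebra_simps power2_eq_square)
    then have "int p dvd y - z \<or> int p dvd y - (- z)"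
      using assms by (simp add: prime_dvd_mult_iff)
    then have "y mod int p = z mod int p \<or> y mod int p = (- z) mod int p"
      by (simp only: mod_eq_dvd_iff)
    then show "y \<in> {z mod int p, (- z) mod int p}"
      using y by simp
  qed
  then have "card {y \<in> {0..<int p}. [y\<^sup>2 = c] (mod int p)} \<le> card {z mod int p, (- z) mod int p}"
    by (intro card_mono) auto
  also have "\<dots> \<le> 2"
    by (simp add: card_insert_if)
  finally show ?thesis .
qed (simp only: card.empty)

text \<open>The affine points fibre over the \<open>p\<close> values of \<open>x\<close>, with at
  most two points in each fibre; the point at infinity supplies the 1 in both bounds.\<close>

lemma card_weierstrass_points_bounds:
  assumes "prime p"
  shows "1 \<le> card (weierstrass_points A B p)" "card (weierstrass_points A B p) \<le> 2 * p + 1"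
proof -
  define F where "F x = {y \<in> {0..<int p}. [y\<^sup>2 = x ^ 3 + A * x + B] (mod int p)}" for x
  have eq: "weierstrass_points A B p = insert None (Some ` (SIGMA x:{0..<int p}. F x))"
    unfolding weierstrass_points_def F_def by (intro arg_cong[where f = "insert None"] image_cong) auto
  have fin: "finite (F x)" for x
    unfolding F_def by (rule finite_subset[of _ "{0..<int p}"]) auto
  then have finS: "finite (SIGMA x:{0..<int p}. F x)"
    by blast
  then have card: "card (weierstrass_points A B p) = Suc (card (SIGMA x:{0..<int p}. F x))"
    unfolding eq by (subst card_insert_disjoint) (auto simp: card_image)
  then show "1 \<le> card (weierstrass_points A B p)"
    by simp
  have "card (SIGMA x:{0..<int p}. F x) = (\<Sum>x\<in>{0..<int p}. card (F x))"
    using fin by simp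
  also have "\<dots> \<le> (\<Sum>x\<in>{0..<int p}. 2)"
    unfolding F_def by (intro sum_mono card_sqrt_mod_prime_le_2 assms)
  finally show "card (weierstrass_points A B p) \<le> 2 * p + 1"
    using card by simp
qed

text \<open>The two bounds on the count place it within distance \<open>p\<close> of
  \<open>p + 1\<close>.\<close>

lemma abs_a_p_le:
  assumes "prime p"
  shows "\<bar>a_p p\<bar> \<le> int p"
  using card_weierstrass_points_bounds[OF assms, of 8 0]
  unfolding a_p_def E0_points_def by linarith

section \<open>The discriminant \<open>Delta\<close> and the roots \<open>w_plus\<close>,
  \<open>w_minus\<close>\<close>

lemma a_p_square_less_Delta:
  assumes "prime p"
  shows "(a_p p)\<^sup>2 < Delta p"
proof -
  have "(a_p p)\<^sup>2 \<le> (int p)\<^sup>2"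
    using abs_a_p_le[OF assms] by (metis abs_le_square_iff abs_of_nat)
  moreover have "0 < int p"
    using prime_gt_0_nat[OF assms] by simp
  moreover have "Delta p = 4 * (int p)\<^sup>2 + 4 * int p - (a_p p)\<^sup>2"
    unfolding Delta_def by (simp add: algebra_simps power2_eq_square)
  \<comment> \<open>\<open>Delta p - (a_p p)\<^sup>2\<close> is at least
    \<open>2 p\<^sup>2 + 4 p\<close>. This is stronger than positivity of \<open>Delta p\<close>: it
    makes the square root outweigh \<open>a_p p\<close>, which fixes the signs of both
    roots.\<close>
  ultimately show ?thesis
    using zero_le_power2[of "int p"] by linarith
qed

lemma abs_a_p_less_sqrt_Delta:
  assumes "prime p"
  shows "\<bar>real_of_int (a_p p)\<bar> < sqrt (real_of_int (Delta p))"
proof -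
  have "real_of_int ((a_p p)\<^sup>2) < real_of_int (Delta p)"
    using a_p_square_less_Delta[OF assms] by (simp only: of_int_less_iff)
  then show ?thesis
    by (intro real_less_rsqrt) simp
qed

lemma w_plus_pos:
  assumes "prime p"
  shows "0 < w_plus p"
  using abs_a_p_less_sqrt_Delta[OF assms] prime_gt_0_nat[OF assms]
  unfolding w_plus_def by (intro divide_pos_pos) auto

lemma w_minus_neg:
  assumes "prime p"
  shows "w_minus p < 0"
  using abs_a_p_less_sqrt_Delta[OF assms] prime_gt_0_nat[OF assms]
  unfolding w_minus_def by (intro divide_neg_pos) auto

text \<open>For nonzero \<open>w\<close>, this says that the pencil at a basepoint over
  \<open>w\<close> has determinant \<open>1 / p\<close>. It involves no choice of sign, so both
  roots can be treated together.\<close>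

definition w_equation :: "nat \<Rightarrow> real \<Rightarrow> bool" where
  "w_equation p w \<longleftrightarrow>
     (w - of_int (a_p p) / (2 * of_nat p))\<^sup>2 + (of_int (a_p p) / (2 * of_nat p))\<^sup>2 = 1 + 1 / of_nat p"

lemma w_equation_w_plus_w_minus:
  assumes "prime p"
  shows "w_equation p (w_plus p)" "w_equation p (w_minus p)"
proof -
  define d where "d = sqrt (real_of_int (Delta p))"
  have p: "real p > 0"
    using prime_gt_0_nat[OF assms] by simp
  have "0 \<le> real_of_int (Delta p)"
    using a_p_square_less_Delta[OF assms] by (metis less_imp_le of_int_0_le_iff order_trans zero_le_power2)
  then have "d\<^sup>2 = 4 * real p * (real p + 1) - (real_of_int (a_p p))\<^sup>2"
    unfolding d_def by (simp add: Delta_def)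
  \<comment> \<open>Divide \<open>d\<^sup>2 + (a_p p)\<^sup>2 = 4 p (p + 1)\<close> by
    \<open>4 p\<^sup>2\<close>.\<close>
  then have "(d / (2 * real p))\<^sup>2 + (real_of_int (a_p p) / (2 * real p))\<^sup>2 = 1 + 1 / real p"
    using p by (simp add: power_divide add_divide_distrib[symmetric])
      (simp add: field_simps power2_eq_square)
  moreover have "w_plus p - real_of_int (a_p p) / (2 * real p) = d / (2 * real p)"
    "w_minus p - real_of_int (a_p p) / (2 * real p) = - (d / (2 * real p))"
    unfolding w_plus_def w_minus_def d_def by (simp_all add: add_divide_distrib diff_divide_distrib)
  ultimately show "w_equation p (w_plus p)" "w_equation p (w_minus p)"
    unfolding w_equation_def by simp_all
qed

section \<open>Basepoints without branch choices\<close>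

lemma lambda_of_eq:
  assumes "w \<noteq> 0"
  shows "lambda_of p w =
    csqrt (complex_of_real w) * (complex_of_real w - of_int (a_p p) / (2 * of_nat p))"
proof -
  have "complex_of_real w powr (3/2) = complex_of_real w powr (1 + 1/2)"
    by simp
  \<comment> \<open>Both powers use the same principal logarithm, so exponents add for negative
    \<open>w\<close> as well.\<close>
  also have "\<dots> = complex_of_real w * complex_of_real w powr (1/2)"
    using assms by (subst powr_add) simp
  finally show ?thesis
    using assms by (simp add: lambda_of_def csqrt_conv_powr algebra_simps)
qed

lemma basepoints_of_eq:
  assumes "w \<noteq> 0"
  shows "basepoints_of p w =
    {(csqrt (complex_of_real w), lambda_of p w), (- csqrt (complex_of_real w), - lambda_of p w)}"
proof -
  have "u\<^sup>2 = complex_of_real w \<longleftrightarrow> u = csqrt (complex_of_real w) \<or> u = - csqrt (complex_of_real w)" for u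
    by (metis power2_csqrt power2_eq_iff)
  moreover have "- csqrt (complex_of_real w) \<noteq> csqrt (complex_of_real w)"
    using assms by simp
  ultimately show ?thesis
    unfolding basepoints_of_def by auto
qed

text \<open>Negating \<open>u\<close> negates \<open>l\<close>, so both square roots satisfy one
  algebraic relation; the determinant computation uses only this form.\<close>

lemma basepoints_of_lambda_eq:
  assumes "w \<noteq> 0" "(u, l) \<in> basepoints_of p w"
  shows "u\<^sup>2 = complex_of_real w" "l = u * (complex_of_real w - of_int (a_p p) / (2 * of_nat p))"
  using assms by (auto simp: basepoints_of_eq lambda_of_eq)

section \<open>The pencil and the polynomial \<open>P\<close>\<close>

lemma pencil_nth:
  "pencil u l $ 1 $ 1 = u\<^sup>2 - 1 - l / u" "pencil u l $ 1 $ 2 = - (l / u)"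
  "pencil u l $ 2 $ 1 = l / u" "pencil u l $ 2 $ 2 = u\<^sup>2 + 1 - l / u"
  by (simp_all add: pencil_def L_S_def V_def mat_def map_matrix_def divide_inverse)

text \<open>With \<open>q = l / u\<close>, the diagonal contributes
  \<open>(u\<^sup>2 - q)\<^sup>2 - 1\<close> and the skew off-diagonal entries add
  \<open>q\<^sup>2\<close>.\<close>

lemma det_pencil: "det (pencil u l) = u ^ 4 - 1 - 2 * u\<^sup>2 * (l / u) + 2 * (l / u)\<^sup>2"
  unfolding det_2 pencil_nth by (simp add: algebra_simps power2_eq_square power4_eq_xxxx)

text \<open>The factor \<open>u\<^sup>2\<close> clears the denominators. At \<open>u = 0\<close> the
  left side is 0 but the right side is \<open>2 * l\<^sup>2\<close>.\<close>

lemma P_eq: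
  assumes "u \<noteq> 0"
  shows "P u l = u ^ 6 - u\<^sup>2 - 2 * l * u ^ 3 + 2 * l\<^sup>2"
  using assms by (simp add: P_def det_pencil field_simps eval_nat_numeral)

section \<open>Inverses and characteristic polynomials of two-by-two matrices\<close>

lemma matrix_inv_2_nth:
  fixes A :: "'a::field ^ 2 ^ 2"
  assumes "det A \<noteq> 0"
  shows "matrix_inv A $ 1 $ 1 = A $ 2 $ 2 / det A" "matrix_inv A $ 1 $ 2 = - A $ 1 $ 2 / det A"
    "matrix_inv A $ 2 $ 1 = - A $ 2 $ 1 / det A" "matrix_inv A $ 2 $ 2 = A $ 1 $ 1 / det A"
proof -
  define B :: "'a ^ 2 ^ 2" where
    "B = vector [vector [A $ 2 $ 2 / det A, - A $ 1 $ 2 / det A],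
                 vector [- A $ 2 $ 1 / det A, A $ 1 $ 1 / det A]]"
  have "A ** B = mat 1" "B ** A = mat 1"
    using assms unfolding det_2
    by (simp_all add: B_def det_2 vec_eq_iff forall_2 matrix_matrix_mult_def sum_2 mat_def
        divide_simps)
  \<comment> \<open>\<open>matrix_inv\<close> is a \<open>SOME\<close> choice; the adjugate formula
    \<open>B\<close> is a two-sided inverse, and associativity makes such an inverse unique.\<close>
  then have "matrix_inv A = B"
    unfolding matrix_inv_def
    by (intro some_equality) (auto, metis matrix_mul_assoc matrix_mul_lid matrix_mul_rid)
  then show "matrix_inv A $ 1 $ 1 = A $ 2 $ 2 / det A" "matrix_inv A $ 1 $ 2 = - A $ 1 $ 2 / det A"
    "matrix_inv A $ 2 $ 1 = - A $ 2 $ 1 / det A" "matrix_inv A $ 2 $ 2 = A $ 1 $ 1 / det A"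
    by (simp_all add: B_def)
qed

text \<open>In size two the adjugate has the same trace as the matrix; the determinant follows by
  multiplicativity.\<close>

lemma trace_det_matrix_inv_2:
  fixes A :: "'a::field ^ 2 ^ 2"
  assumes "det A \<noteq> 0"
  shows "trace (matrix_inv A) = trace A / det A" "det (matrix_inv A) = 1 / det A"
proof -
  show "trace (matrix_inv A) = trace A / det A"
    using assms by (simp add: trace_def sum_2 matrix_inv_2_nth add_divide_distrib)
  have "A ** matrix_inv A = mat 1"
    using assms unfolding invertible_det_nz[symmetric] invertible_def matrix_inv_def
    by (rule someI2_ex) blast
  then have "det A * det (matrix_inv A) = 1"
    by (metis det_I det_mul)
  then show "det (matrix_inv A) = 1 / det A"
    using assms by (simp add: field_simps)
qed

lemma det_one_minus_scaled_2:
  fixes R :: "'a::comm_ring_1 ^ 2 ^ 2"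
  shows "det (mat 1 - map_matrix ((*) t) R) = 1 - trace R * t + det R * t\<^sup>2"
  by (simp add: det_2 trace_def sum_2 map_matrix_def mat_def algebra_simps power2_eq_square)

text \<open>Here the scalar is the indeterminate: \<open>monom r 1\<close> is \<open>r\<close> times
  it, and the determinant is taken over the polynomial ring. This is the form that expresses an
  identity of polynomials.\<close>

lemma det_one_minus_monom_2:
  fixes R :: "'a::comm_ring_1 ^ 2 ^ 2"
  shows "det (mat 1 - map_matrix (\<lambda>r. monom r 1) R) = [: 1, - trace R, det R :]"
  by (simp add: det_2 trace_def sum_2 map_matrix_def mat_def monom_altdef algebra_simps
      one_pCons)

text \<open>Turns the last term of the Euler factor into \<open>p * t\<^sup>2\<close> with
  \<open>t = p powr (- s)\<close>, to match the quadratic in \<open>t\<close> given by the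
  determinant.\<close>

lemma of_nat_powr_one_minus_double:
  assumes "p > 0"
  shows "(of_nat p :: complex) powr (1 - 2 * s) = of_nat p * (of_nat p powr (- s))\<^sup>2"
proof -
  have "(of_nat p :: complex) powr (1 - 2 * s) = of_nat p powr (1 + (- s + - s))"
    by (simp add: algebra_simps)
  also have "\<dots> = of_nat p * (of_nat p powr (- s))\<^sup>2"
    using assms unfolding powr_add by (simp add: power2_eq_square)
  finally show ?thesis .
qed

section \<open>The resolvent at a basepoint\<close>

lemma trace_det_pencil_basepoint:
  assumes "w \<noteq> 0" "w_equation p w" "(u, l) \<in> basepoints_of p w"
  shows "trace (pencil u l) = of_int (a_p p) / of_nat p" "det (pencil u l) = 1 / of_nat p"
proof -
  define b :: complex where "b = of_int (a_p p) / (2 * of_nat p)"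
  note ul = basepoints_of_lambda_eq[OF assms(1,3), folded b_def]
  have "u \<noteq> 0"
    using ul(1) assms(1) by auto
  then have lu: "l / u = complex_of_real w - b"
    using ul(2) by simp
  have "trace (pencil u l) = 2 * b"
    using ul(1) lu by (simp add: trace_def sum_2 pencil_nth)
  then show "trace (pencil u l) = of_int (a_p p) / of_nat p"
    by (simp add: b_def)
  have "complex_of_real ((w - of_int (a_p p) / (2 * of_nat p))\<^sup>2 + (of_int (a_p p) / (2 * of_nat p))\<^sup>2)
      = complex_of_real (1 + 1 / of_nat p)"
    using assms(2) unfolding w_equation_def by (rule arg_cong)
  then have circ: "(complex_of_real w - b)\<^sup>2 + b\<^sup>2 = 1 + 1 / of_nat p"
    by (simp add: b_def)
  have "u ^ 4 = (complex_of_real w)\<^sup>2"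
    by (simp flip: ul(1))
  \<comment> \<open>With \<open>q = w - b\<close>, the terms
    \<open>w\<^sup>2 - 2 w q + 2 q\<^sup>2\<close> regroup as
    \<open>(w - q)\<^sup>2 + q\<^sup>2\<close>, and \<open>w - q = b\<close>.\<close>
  then have "det (pencil u l) = (complex_of_real w - b)\<^sup>2 + b\<^sup>2 - 1"
    unfolding det_pencil lu ul(1) by (simp add: algebra_simps power2_eq_square)
  then show "det (pencil u l) = 1 / of_nat p"
    using circ by simp
qed

text \<open>A determinant \<open>1 / p\<close> makes the inverse genuine and turns the trace
  \<open>a_p / p\<close> into \<open>a_p\<close>; also \<open>P u l\<close> is
  \<open>u\<^sup>2 = w\<close> times \<open>1 / p\<close>. One statement serves both roots and both
  signs of \<open>u\<close>.\<close>

lemma euler_factor_at_basepoint: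
  assumes "p > 0" "w \<noteq> 0" "w_equation p w" "(u, l) \<in> basepoints_of p w"
  shows "invertible (pencil u l)"
    "det (mat 1 - map_matrix ((*) (of_nat p powr (- s))) (resolvent u l)) =
       1 - of_int (a_p p) * of_nat p powr (- s) + of_nat p powr (1 - 2 * s)"
    "det (mat 1 - map_matrix (\<lambda>r. monom r 1) (resolvent u l)) = [: 1, - of_int (a_p p), of_nat p :]"
    "P u l = complex_of_real (w / of_nat p)"
proof -
  note td = trace_det_pencil_basepoint[OF assms(2-4)]
  have nz: "det (pencil u l) \<noteq> 0"
    using td(2) assms(1) by simp
  then show "invertible (pencil u l)"
    by (simp add: invertible_det_nz)
  have R: "trace (resolvent u l) = of_int (a_p p)" "det (resolvent u l) = of_nat p"
    unfolding resolvent_def trace_det_matrix_inv_2[OF nz] td using assms(1) by simp_all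
  show "det (mat 1 - map_matrix ((*) (of_nat p powr (- s))) (resolvent u l)) =
       1 - of_int (a_p p) * of_nat p powr (- s) + of_nat p powr (1 - 2 * s)"
    unfolding det_one_minus_scaled_2 R of_nat_powr_one_minus_double[OF assms(1)] ..
  show "det (mat 1 - map_matrix (\<lambda>r. monom r 1) (resolvent u l)) = [: 1, - of_int (a_p p), of_nat p :]"
    unfolding det_one_minus_monom_2 R ..
  show "P u l = complex_of_real (w / of_nat p)"
    unfolding P_def td(2) basepoints_of_lambda_eq(1)[OF assms(2,4)] by simp
qed

section \<open>Real and non-real basepoints\<close>

lemma basepoints_of_pos_real:
  assumes "w > 0" "b \<in> basepoints_of p w"
  shows "real_point b"
proof -
  obtain u l where b: "b = (u, l)" by fastforce
  have "csqrt (complex_of_real w) \<in> \<real>"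
    using assms(1) by (simp add: of_real_sqrt[symmetric])
  then have u: "u \<in> \<real>"
    using assms b by (auto simp: basepoints_of_eq)
  have "l = u * (complex_of_real w - complex_of_real (of_int (a_p p) / (2 * of_nat p)))"
    using basepoints_of_lambda_eq(2)[of w u l p] assms b by simp
  also have "\<dots> \<in> \<real>"
    using u by (intro Reals_mult Reals_diff Reals_of_real)
  finally show ?thesis
    using u b by (simp add: real_point_def)
qed

lemma basepoints_of_neg_not_real:
  assumes "w < 0" "b \<in> basepoints_of p w"
  shows "\<not> real_point b"
proof
  assume "real_point b"
  then obtain r where "fst b = complex_of_real r"
    unfolding real_point_def by (auto elim: Reals_cases)
  moreover have "(fst b)\<^sup>2 = complex_of_real w"
    using basepoints_of_lambda_eq(1)[of w "fst b" "snd b" p] assms by simp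
  \<comment> \<open>The first coordinate alone is the obstruction: a real \<open>u\<close> would
    have a negative square.\<close>
  ultimately have "r\<^sup>2 = w"
    by (metis of_real_eq_iff of_real_power)
  then show False
    using assms(1) by (metis not_less zero_le_power2)
qed

theorem mainTheorem2:
  shows
    "(\<forall>u l. u \<noteq> 0 \<longrightarrow> P u l = u ^ 6 - u\<^sup>2 - 2 * l * u ^ 3 + 2 * l\<^sup>2) \<and>
     (\<forall>p :: nat. prime p \<and> p \<noteq> 2 \<longrightarrow>
       \<comment> \<open>(a)\<close>
       Delta p > 0 \<and>
       \<comment> \<open>(b)\<close>
       (w_plus p > 0 \<and>
        basepoints_of p (w_plus p) =
          {(complex_of_real (sqrt (w_plus p)), lambda_plus p), (- complex_of_real (sqrt (w_plus p)), - lambda_plus p)} \<and>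
        (complex_of_real (sqrt (w_plus p)), lambda_plus p) \<noteq> (- complex_of_real (sqrt (w_plus p)), - lambda_plus p) \<and>
        (\<forall>b \<in> basepoints_of p (w_plus p). real_point b) \<and>
        w_minus p < 0 \<and>
        (\<forall>b \<in> basepoints_of p (w_minus p). \<not> real_point b) \<and>
        (\<forall>(u, l) \<in> basepoints p. real_point (u, l) \<longrightarrow> P u l \<noteq> 0) \<and>
        P (complex_of_real (sqrt (w_plus p))) (lambda_plus p) = complex_of_real (w_plus p / of_nat p) \<and>
        P (- complex_of_real (sqrt (w_plus p))) (- lambda_plus p) = complex_of_real (w_plus p / of_nat p)) \<and>
       \<comment> \<open>(c): the identity in \<open>p\<^sup>-\<^sup>s\<close>, both for all complex \<open>s\<close> and as polynomials\<close>
       (let u = complex_of_real (sqrt (w_plus p)); R = resolvent u (lambda_plus p) in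
          invertible (pencil u (lambda_plus p)) \<and>
          (\<forall>s :: complex. det (mat 1 - map_matrix ((*) (of_nat p powr (- s))) R) =
             1 - of_int (a_p p) * of_nat p powr (- s) + of_nat p powr (1 - 2 * s)) \<and>
          det (mat 1 - map_matrix (\<lambda>r. monom r 1) R) = [: 1, - of_int (a_p p), of_nat p :]) \<and>
       (csqrt (complex_of_real (w_minus p)), lambda_minus p) \<in> basepoints_of p (w_minus p) \<and>
       (\<forall>(u, l) \<in> basepoints_of p (w_minus p).
          let R = resolvent u l in
          invertible (pencil u l) \<and>
          (\<forall>s :: complex. det (mat 1 - map_matrix ((*) (of_nat p powr (- s))) R) =
             1 - of_int (a_p p) * of_nat p powr (- s) + of_nat p powr (1 - 2 * s)) \<and>
          det (mat 1 - map_matrix (\<lambda>r. monom r 1) R) = [: 1, - of_int (a_p p), of_nat p :] \<and>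
          \<not> real_point (u, l)))"
proof (intro conjI allI impI)
  fix u l :: complex
  assume "u \<noteq> 0"
  then show "P u l = u ^ 6 - u\<^sup>2 - 2 * l * u ^ 3 + 2 * l\<^sup>2"
    by (rule P_eq)
next
  fix p :: nat
  assume "prime p \<and> p \<noteq> 2"
  then have p: "prime p" by simp
  have p0: "p > 0"
    using p by (rule prime_gt_0_nat)
  note wp = w_plus_pos[OF p] and wm = w_minus_neg[OF p]
  have wp0: "w_plus p \<noteq> 0" and wm0: "w_minus p \<noteq> 0"
    using wp wm by auto
  note eq = w_equation_w_plus_w_minus[OF p]
  note plus = euler_factor_at_basepoint[OF p0 wp0 eq(1)]
  note minus = euler_factor_at_basepoint[OF p0 wm0 eq(2)]
  let ?u = "complex_of_real (sqrt (w_plus p))"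
  have sq: "csqrt (complex_of_real (w_plus p)) = ?u"
    using wp by simp
  show "Delta p > 0"
    using a_p_square_less_Delta[OF p] by (rule le_less_trans[OF zero_le_power2])
  show "w_plus p > 0" "w_minus p < 0"
    by fact+
  show bp: "basepoints_of p (w_plus p) = {(?u, lambda_plus p), (- ?u, - lambda_plus p)}"
    unfolding basepoints_of_eq[OF wp0] sq lambda_plus_def ..
  show "(?u, lambda_plus p) \<noteq> (- ?u, - lambda_plus p)"
    using wp by simp
  show "\<forall>b\<in>basepoints_of p (w_plus p). real_point b"
    using basepoints_of_pos_real[OF wp] by blast
  show notreal: "\<forall>b\<in>basepoints_of p (w_minus p). \<not> real_point b"
    using basepoints_of_neg_not_real[OF wm] by blast
  \<comment> \<open>A real basepoint must lie over \<open>w_plus p\<close>, where \<open>P\<close>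
    takes the nonzero value \<open>w_plus p / p\<close>.\<close>
  show "\<forall>(u, l)\<in>basepoints p. real_point (u, l) \<longrightarrow> P u l \<noteq> 0"
    using plus(4) notreal wp0 p0 unfolding basepoints_def by fastforce
  have b1: "(?u, lambda_plus p) \<in> basepoints_of p (w_plus p)"
    and b2: "(- ?u, - lambda_plus p) \<in> basepoints_of p (w_plus p)"
    unfolding bp by simp_all
  show "P ?u (lambda_plus p) = complex_of_real (w_plus p / of_nat p)"
    by (rule plus(4)[OF b1])
  show "P (- ?u) (- lambda_plus p) = complex_of_real (w_plus p / of_nat p)"
    by (rule plus(4)[OF b2])
  show "let u = ?u; R = resolvent u (lambda_plus p) in
          invertible (pencil u (lambda_plus p)) \<and>
          (\<forall>s :: complex. det (mat 1 - map_matrix ((*) (of_nat p powr (- s))) R) =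
             1 - of_int (a_p p) * of_nat p powr (- s) + of_nat p powr (1 - 2 * s)) \<and>
          det (mat 1 - map_matrix (\<lambda>r. monom r 1) R) = [: 1, - of_int (a_p p), of_nat p :]"
    unfolding Let_def using plus(1-3)[OF b1] by blast
  show "(csqrt (complex_of_real (w_minus p)), lambda_minus p) \<in> basepoints_of p (w_minus p)"
    unfolding basepoints_of_eq[OF wm0] lambda_minus_def by simp
  show "\<forall>(u, l) \<in> basepoints_of p (w_minus p).
          let R = resolvent u l in
          invertible (pencil u l) \<and>
          (\<forall>s :: complex. det (mat 1 - map_matrix ((*) (of_nat p powr (- s))) R) =
             1 - of_int (a_p p) * of_nat p powr (- s) + of_nat p powr (1 - 2 * s)) \<and>
          det (mat 1 - map_matrix (\<lambda>r. monom r 1) R) = [: 1, - of_int (a_p p), of_nat p :] \<and>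
          \<not> real_point (u, l)"
    unfolding Let_def using minus(1-3) notreal by blast
qed

end
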